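(* Let $\mathbf K$ be a small monoidal triangulated category, and for $A\in\mathbf K$ put $V(A)=\{\mathbf P\in\mathrm{Spc}\,\mathbf K: A\notin\mathbf P\}$. (a) The map $V$ is the final object in the collection of support data $\sigma$ (on arbitrary topological spaces $X$) such that $\sigma(A)$ is closed for each $A\in\mathbf K$: $V$ belongs to this collection, and for any such $\sigma:\mathbf K\to\mathcal X$ there is a unique continuous map $f_\sigma:X\to\mathrm{Spc}\,\mathbf K$ satisfying $\sigma(A)=f_\sigma^{-1}(V(A))$ for all $A\in\mathbf K$. (b) The map $V$ is the final object in the collection of weak support data $\sigma$ (on arbitrary topological spaces $X$) such that $\Phi_\sigma(\langle A\rangle)$ is closed for each $A\in\mathbf K$: $V$ belongs to this collection, and for any such $\sigma:\mathbf K\to\mathcal X$ there is a unique continuous map $f_\sigma:X\to\mathrm{Spc}\,\mathbf K$ satisfying $\Phi_\sigma(\langle A\rangle)=f_\sigma^{-1}(V(A))$ for all $A\in\mathbf K$.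
   Context: A monoidal triangulated category (M$\Delta$C) is a monoidal category $\mathbf K$ (unit $1$) which is also triangulated (shift $\Sigma$) and for which $\otimes$ is an exact bifunctor; no symmetry or braiding is assumed. A thick (two-sided) ideal is a full triangulated subcategory closed under direct summands and under left and right tensoring with arbitrary objects of $\mathbf K$; $\langle A\rangle$ is the smallest thick ideal containing $A$. For thick ideals $\mathbf I,\mathbf J$, $\mathbf I\otimes\mathbf J=\{A\otimes B:A\in\mathbf I,B\in\mathbf J\}$. A prime ideal is a proper thick ideal $\mathbf P$ such that $\mathbf I\otimes\mathbf J\subseteq\mathbf P$ implies $\mathbf I\subseteq\mathbf P$ or $\mathbf J\subseteq\mathbf P$ for all thick ideals $\mathbf I,\mathbf J$. $\mathrm{Spc}\,\mathbf K$ is the set of prime ideals with the topology whose closed sets are $V(\mathcal S)=\{\mathbf P:\mathbf P\cap\mathcal S=\varnothing\}$, $\mathcal S\subseteq\mathbf K$. For a topological space $X$ let $\mathcal X$ be the set of all subsets of $X$. For a map $\sigma:\mathbf K\to\mathcal X$ (defined on objects) and a collection $\mathcal S$ of objects put $\Phi_\sigma(\mathcal S)=\bigcup_{A\in\mathcal S}\sigma(A)$. Consider the conditions: (i) $\sigma(0)=\varnothing$, $\sigma(1)=X$; (ii) $\sigma(A\oplus B)=\sigma(A)\cup\sigma(B)$ for all $A,B$; (iii) $\sigma(\Sigma A)=\sigma(A)$ for all $A$; (iv) if $A\to B\to C\to\Sigma A$ is a distinguished triangle, then $\sigma(A)\subseteq\sigma(B)\cup\sigma(C)$; (v) $\bigcup_{C\in\mathbf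 K}\sigma(A\otimes C\otimes B)=\sigma(A)\cap\sigma(B)$ for all $A,B$; (v') $\Phi_\sigma(\mathbf I\otimes\mathbf J)=\Phi_\sigma(\mathbf I)\cap\Phi_\sigma(\mathbf J)$ for all thick ideals $\mathbf I,\mathbf J$ of $\mathbf K$. A support datum is a map $\sigma$ satisfying (i)–(v); a weak support datum is a map satisfying (i)–(iv) and (v'). *)

theory Defs
  imports "HOL-Algebra.Group" "HOL-Analysis.Abstract_Topology"
begin

section \<open>Categories\<close>

text \<open>Objects and arrows form sets inside the types \<open>'o\<close> and \<open>'m\<close>, so every category here is small.\<close>

record ('o, 'm) cat =
  Obj :: "'o set"
  Arr :: "'m set"
  Dom :: "'m \<Rightarrow> 'o"
  Cod :: "'m \<Rightarrow> 'o"
  Ide :: "'o \<Rightarrow> 'm"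
  Comp :: "'m \<Rightarrow> 'm \<Rightarrow> 'm" (infixr "\<cdot>\<index>" 70)

definition Hom :: "('o, 'm, 'z) cat_scheme \<Rightarrow> 'o \<Rightarrow> 'o \<Rightarrow> 'm set" where
  "Hom K A B = {f \<in> Arr K. Dom K f = A \<and> Cod K f = B}"

locale category =
  fixes K :: "('o, 'm, 'z) cat_scheme" (structure)
  assumes Dom_Obj: "f \<in> Arr K \<Longrightarrow> Dom K f \<in> Obj K"
    and Cod_Obj: "f \<in> Arr K \<Longrightarrow> Cod K f \<in> Obj K"
    and Ide_Hom: "A \<in> Obj K \<Longrightarrow> Ide K A \<in> Hom K A A"
    and Comp_Hom: "f \<in> Hom K A B \<Longrightarrow> g \<in> Hom K B C \<Longrightarrow> g \<cdot> f \<in> Hom K A C"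
    and Comp_Ide: "f \<in> Hom K A B \<Longrightarrow> f \<cdot> Ide K A = f"
    and Ide_Comp: "f \<in> Hom K A B \<Longrightarrow> Ide K B \<cdot> f = f"
    and Comp_assoc: "f \<in> Hom K A B \<Longrightarrow> g \<in> Hom K B C \<Longrightarrow> h \<in> Hom K C D \<Longrightarrow>
          (h \<cdot> g) \<cdot> f = h \<cdot> (g \<cdot> f)"

definition iso_arr :: "('o, 'm, 'z) cat_scheme \<Rightarrow> 'o \<Rightarrow> 'o \<Rightarrow> 'm \<Rightarrow> bool" where
  "iso_arr K A B f \<longleftrightarrow> f \<in> Hom K A B \<and>
     (\<exists>g \<in> Hom K B A. g \<cdot>\<^bsub>K\<^esub> f = Ide K A \<and> f \<cdot>\<^bsub>K\<^esub> g = Ide K B)"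

definition isomorphic :: "('o, 'm, 'z) cat_scheme \<Rightarrow> 'o \<Rightarrow> 'o \<Rightarrow> bool" where
  "isomorphic K A B \<longleftrightarrow> A \<in> Obj K \<and> B \<in> Obj K \<and> (\<exists>f. iso_arr K A B f)"

definition zero_object :: "('o, 'm, 'z) cat_scheme \<Rightarrow> 'o \<Rightarrow> bool" where
  "zero_object K Z \<longleftrightarrow> Z \<in> Obj K \<and>
     (\<forall>A \<in> Obj K. (\<exists>!f. f \<in> Hom K A Z) \<and> (\<exists>!f. f \<in> Hom K Z A))"

definition endofunctor ::
  "('o, 'm, 'z) cat_scheme \<Rightarrow> ('o \<Rightarrow> 'o) \<Rightarrow> ('m \<Rightarrow> 'm) \<Rightarrow> bool" where
  "endofunctor K F\<^sub>o F\<^sub>m \<longleftrightarrow>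
     (\<forall>A \<in> Obj K. F\<^sub>o A \<in> Obj K \<and> F\<^sub>m (Ide K A) = Ide K (F\<^sub>o A)) \<and>
     (\<forall>A B f. f \<in> Hom K A B \<longrightarrow> F\<^sub>m f \<in> Hom K (F\<^sub>o A) (F\<^sub>o B)) \<and>
     (\<forall>A B C f g. f \<in> Hom K A B \<longrightarrow> g \<in> Hom K B C \<longrightarrow>
        F\<^sub>m (g \<cdot>\<^bsub>K\<^esub> f) = F\<^sub>m g \<cdot>\<^bsub>K\<^esub> F\<^sub>m f)"

definition autoequivalence ::
  "('o, 'm, 'z) cat_scheme \<Rightarrow> ('o \<Rightarrow> 'o) \<Rightarrow> ('m \<Rightarrow> 'm) \<Rightarrow> bool" where
  "autoequivalence K F\<^sub>o F\<^sub>m \<longleftrightarrow> endofunctor K F\<^sub>o F\<^sub>m \<and>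
     (\<forall>A \<in> Obj K. \<forall>B \<in> Obj K. bij_betw F\<^sub>m (Hom K A B) (Hom K (F\<^sub>o A) (F\<^sub>o B))) \<and>
     (\<forall>B \<in> Obj K. \<exists>A \<in> Obj K. isomorphic K (F\<^sub>o A) B)"


section \<open>Additive categories\<close>

record ('o, 'm) add_cat = "('o, 'm) cat" +
  Add :: "'m \<Rightarrow> 'm \<Rightarrow> 'm" (infixl "\<boxplus>\<index>" 65)
  Zero :: "'o \<Rightarrow> 'o \<Rightarrow> 'm"

definition Hom_group :: "('o, 'm, 'z) add_cat_scheme \<Rightarrow> 'o \<Rightarrow> 'o \<Rightarrow> 'm monoid" where
  "Hom_group K A B = \<lparr>carrier = Hom K A B, mult = Add K, one = Zero K A B\<rparr>"

text \<open>\<^term>\<open>biproduct K A B S\<close> says that \<open>S\<close> is a direct sum of \<open>A\<close> and \<open>B\<close>.  Direct sums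
  and zero objects are treated up to isomorphism throughout; none is chosen.\<close>

definition biproduct :: "('o, 'm, 'z) add_cat_scheme \<Rightarrow> 'o \<Rightarrow> 'o \<Rightarrow> 'o \<Rightarrow> bool" where
  "biproduct K A B S \<longleftrightarrow> A \<in> Obj K \<and> B \<in> Obj K \<and> S \<in> Obj K \<and>
     (\<exists>i \<in> Hom K A S. \<exists>j \<in> Hom K B S. \<exists>p \<in> Hom K S A. \<exists>q \<in> Hom K S B.
        p \<cdot>\<^bsub>K\<^esub> i = Ide K A \<and> q \<cdot>\<^bsub>K\<^esub> j = Ide K B \<and>
        p \<cdot>\<^bsub>K\<^esub> j = Zero K B A \<and> q \<cdot>\<^bsub>K\<^esub> i = Zero K A B \<and>
        (i \<cdot>\<^bsub>K\<^esub> p) \<boxplus>\<^bsub>K\<^esub> (j \<cdot>\<^bsub>K\<^esub> q) = Ide K S)"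

locale additive_category = category K
  for K :: "('o, 'm, 'z) add_cat_scheme" (structure) +
  assumes Hom_comm_group: "A \<in> Obj K \<Longrightarrow> B \<in> Obj K \<Longrightarrow> comm_group (Hom_group K A B)"
    and Comp_Add_left: "f \<in> Hom K A B \<Longrightarrow> g \<in> Hom K B C \<Longrightarrow> g' \<in> Hom K B C \<Longrightarrow>
          (g \<boxplus> g') \<cdot> f = (g \<cdot> f) \<boxplus> (g' \<cdot> f)"
    and Comp_Add_right: "f \<in> Hom K A B \<Longrightarrow> f' \<in> Hom K A B \<Longrightarrow> g \<in> Hom K B C \<Longrightarrow>
          g \<cdot> (f \<boxplus> f') = (g \<cdot> f) \<boxplus> (g \<cdot> f')"
    and ex_zero_object: "\<exists>Z. zero_object K Z"
    and ex_biproduct: "A \<in> Obj K \<Longrightarrow> B \<in> Obj K \<Longrightarrow> \<exists>S. biproduct K A B S"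

definition additive_endofunctor ::
  "('o, 'm, 'z) add_cat_scheme \<Rightarrow> ('o \<Rightarrow> 'o) \<Rightarrow> ('m \<Rightarrow> 'm) \<Rightarrow> bool" where
  "additive_endofunctor K F\<^sub>o F\<^sub>m \<longleftrightarrow> endofunctor K F\<^sub>o F\<^sub>m \<and>
     (\<forall>A B. \<forall>f \<in> Hom K A B. \<forall>g \<in> Hom K A B.
        F\<^sub>m (f \<boxplus>\<^bsub>K\<^esub> g) = F\<^sub>m f \<boxplus>\<^bsub>K\<^esub> F\<^sub>m g)"


section \<open>Triangulated categories\<close>

text \<open>\<open>(f, g, h) \<in> Tri K\<close> means that \<open>A \<rightarrow> B \<rightarrow> C \<rightarrow> \<Sigma>A\<close> with arrows \<open>f, g, h\<close> is distinguished;
  the objects are recovered from the domains and codomains.\<close>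

record ('o, 'm) tri_cat = "('o, 'm) add_cat" +
  Shift :: "'o \<Rightarrow> 'o"
  Shift_map :: "'m \<Rightarrow> 'm"
  Tri :: "('m \<times> 'm \<times> 'm) set"

definition triangle ::
  "('o, 'm, 'z) tri_cat_scheme \<Rightarrow> 'o \<Rightarrow> 'o \<Rightarrow> 'o \<Rightarrow> 'm \<Rightarrow> 'm \<Rightarrow> 'm \<Rightarrow> bool" where
  "triangle K A B C f g h \<longleftrightarrow>
     f \<in> Hom K A B \<and> g \<in> Hom K B C \<and> h \<in> Hom K C (Shift K A)"

definition dist_triangle ::
  "('o, 'm, 'z) tri_cat_scheme \<Rightarrow> 'o \<Rightarrow> 'o \<Rightarrow> 'o \<Rightarrow> 'm \<Rightarrow> 'm \<Rightarrow> 'm \<Rightarrow> bool" where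
  "dist_triangle K A B C f g h \<longleftrightarrow> triangle K A B C f g h \<and> (f, g, h) \<in> Tri K"

definition neg_arr :: "('o, 'm, 'z) add_cat_scheme \<Rightarrow> 'm \<Rightarrow> 'm" where
  "neg_arr K f = m_inv (Hom_group K (Dom K f) (Cod K f)) f"

locale triangulated_category = additive_category K
  for K :: "('o, 'm, 'z) tri_cat_scheme" (structure) +
  assumes Shift_autoequivalence: "autoequivalence K (Shift K) (Shift_map K)"
    and Shift_additive: "additive_endofunctor K (Shift K) (Shift_map K)"
    and Tri_triangle: "(f, g, h) \<in> Tri K \<Longrightarrow> \<exists>A B C. triangle K A B C f g h"
    and Tri_iso: "dist_triangle K A B C f g h \<Longrightarrow> triangle K A' B' C' f' g' h' \<Longrightarrow>
          iso_arr K A A' a \<Longrightarrow> iso_arr K B B' b \<Longrightarrow> iso_arr K C C' c \<Longrightarrow>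
          b \<cdot> f = f' \<cdot> a \<Longrightarrow> c \<cdot> g = g' \<cdot> b \<Longrightarrow> Shift_map K a \<cdot> h = h' \<cdot> c \<Longrightarrow>
          dist_triangle K A' B' C' f' g' h'"
    and Tri_Ide: "A \<in> Obj K \<Longrightarrow> zero_object K Z \<Longrightarrow>
          dist_triangle K A A Z (Ide K A) (Zero K A Z) (Zero K Z (Shift K A))"
    and Tri_cone: "f \<in> Hom K A B \<Longrightarrow> \<exists>C g h. dist_triangle K A B C f g h"
    and Tri_rotate: "triangle K A B C f g h \<Longrightarrow>
          dist_triangle K A B C f g h \<longleftrightarrow>
          dist_triangle K B C (Shift K A) g h (neg_arr K (Shift_map K f))"
    and Tri_morphism: "dist_triangle K A B C f g h \<Longrightarrow> dist_triangle K A' B' C' f' g' h' \<Longrightarrow>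
          a \<in> Hom K A A' \<Longrightarrow> b \<in> Hom K B B' \<Longrightarrow> b \<cdot> f = f' \<cdot> a \<Longrightarrow>
          \<exists>c \<in> Hom K C C'. c \<cdot> g = g' \<cdot> b \<and> Shift_map K a \<cdot> h = h' \<cdot> c"
    and Tri_octahedral: "dist_triangle K A B C' f f' f'' \<Longrightarrow> dist_triangle K B C A' g g' g'' \<Longrightarrow>
          dist_triangle K A C B' (g \<cdot> f) h' h'' \<Longrightarrow>
          \<exists>u v. dist_triangle K C' B' A' u v (Shift_map K f' \<cdot> g'') \<and>
            u \<cdot> f' = h' \<cdot> g \<and> h'' \<cdot> u = f'' \<and> v \<cdot> h' = g' \<and> g'' \<cdot> v = Shift_map K f \<cdot> h''"

definition exact_endofunctor ::
  "('o, 'm, 'z) tri_cat_scheme \<Rightarrow> ('o \<Rightarrow> 'o) \<Rightarrow> ('m \<Rightarrow> 'm) \<Rightarrow> bool" where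
  "exact_endofunctor K F\<^sub>o F\<^sub>m \<longleftrightarrow> additive_endofunctor K F\<^sub>o F\<^sub>m \<and>
     (\<exists>\<theta>. (\<forall>A \<in> Obj K. iso_arr K (F\<^sub>o (Shift K A)) (Shift K (F\<^sub>o A)) (\<theta> A)) \<and>
       (\<forall>A B. \<forall>f \<in> Hom K A B.
          \<theta> B \<cdot>\<^bsub>K\<^esub> F\<^sub>m (Shift_map K f) = Shift_map K (F\<^sub>m f) \<cdot>\<^bsub>K\<^esub> \<theta> A) \<and>
       (\<forall>A B C f g h. dist_triangle K A B C f g h \<longrightarrow>
          dist_triangle K (F\<^sub>o A) (F\<^sub>o B) (F\<^sub>o C) (F\<^sub>m f) (F\<^sub>m g) (\<theta> A \<cdot>\<^bsub>K\<^esub> F\<^sub>m h)))"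


section \<open>Monoidal triangulated categories\<close>

record ('o, 'm) mon_tri_cat = "('o, 'm) tri_cat" +
  Tensor :: "'o \<Rightarrow> 'o \<Rightarrow> 'o" (infixl "\<boxtimes>\<index>" 75)
  Tensor_map :: "'m \<Rightarrow> 'm \<Rightarrow> 'm" (infixl "\<star>\<index>" 75)
  Unit :: "'o"
  Assoc :: "'o \<Rightarrow> 'o \<Rightarrow> 'o \<Rightarrow> 'm"
  Lunit :: "'o \<Rightarrow> 'm"
  Runit :: "'o \<Rightarrow> 'm"

locale monoidal_category = category K
  for K :: "('o, 'm, 'z) mon_tri_cat_scheme" (structure) +
  assumes Tensor_Obj: "A \<in> Obj K \<Longrightarrow> B \<in> Obj K \<Longrightarrow> A \<boxtimes> B \<in> Obj K"
    and Tensor_Hom: "f \<in> Hom K A A' \<Longrightarrow> g \<in> Hom K B B' \<Longrightarrow> f \<star> g \<in> Hom K (A \<boxtimes> B) (A' \<boxtimes> B')"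
    and Tensor_Ide: "A \<in> Obj K \<Longrightarrow> B \<in> Obj K \<Longrightarrow> Ide K A \<star> Ide K B = Ide K (A \<boxtimes> B)"
    and Tensor_Comp: "f \<in> Hom K A A' \<Longrightarrow> f' \<in> Hom K A' A'' \<Longrightarrow>
          g \<in> Hom K B B' \<Longrightarrow> g' \<in> Hom K B' B'' \<Longrightarrow>
          (f' \<cdot> f) \<star> (g' \<cdot> g) = (f' \<star> g') \<cdot> (f \<star> g)"
    and Unit_Obj: "Unit K \<in> Obj K"
    and Assoc_iso: "A \<in> Obj K \<Longrightarrow> B \<in> Obj K \<Longrightarrow> C \<in> Obj K \<Longrightarrow>
          iso_arr K ((A \<boxtimes> B) \<boxtimes> C) (A \<boxtimes> (B \<boxtimes> C)) (Assoc K A B C)"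
    and Assoc_natural: "f \<in> Hom K A A' \<Longrightarrow> g \<in> Hom K B B' \<Longrightarrow> h \<in> Hom K C C' \<Longrightarrow>
          Assoc K A' B' C' \<cdot> ((f \<star> g) \<star> h) = (f \<star> (g \<star> h)) \<cdot> Assoc K A B C"
    and Lunit_iso: "A \<in> Obj K \<Longrightarrow> iso_arr K (Unit K \<boxtimes> A) A (Lunit K A)"
    and Lunit_natural: "f \<in> Hom K A B \<Longrightarrow> Lunit K B \<cdot> (Ide K (Unit K) \<star> f) = f \<cdot> Lunit K A"
    and Runit_iso: "A \<in> Obj K \<Longrightarrow> iso_arr K (A \<boxtimes> Unit K) A (Runit K A)"
    and Runit_natural: "f \<in> Hom K A B \<Longrightarrow> Runit K B \<cdot> (f \<star> Ide K (Unit K)) = f \<cdot> Runit K A"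
    and pentagon: "A \<in> Obj K \<Longrightarrow> B \<in> Obj K \<Longrightarrow> C \<in> Obj K \<Longrightarrow> D \<in> Obj K \<Longrightarrow>
          Assoc K A B (C \<boxtimes> D) \<cdot> Assoc K (A \<boxtimes> B) C D =
          (Ide K A \<star> Assoc K B C D) \<cdot> Assoc K A (B \<boxtimes> C) D \<cdot> (Assoc K A B C \<star> Ide K D)"
    and triangle_identity: "A \<in> Obj K \<Longrightarrow> B \<in> Obj K \<Longrightarrow>
          (Ide K A \<star> Lunit K B) \<cdot> Assoc K A (Unit K) B = Runit K A \<star> Ide K B"

text \<open>An exact bifunctor is a bifunctor which is an exact functor in each variable separately.\<close>

locale monoidal_triangulated_category = triangulated_category K + monoidal_category K
  for K :: "('o, 'm, 'z) mon_tri_cat_scheme" (structure) +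
  assumes Tensor_left_exact:
      "A \<in> Obj K \<Longrightarrow> exact_endofunctor K (\<lambda>B. A \<boxtimes> B) (\<lambda>f. Ide K A \<star> f)"
    and Tensor_right_exact:
      "A \<in> Obj K \<Longrightarrow> exact_endofunctor K (\<lambda>B. B \<boxtimes> A) (\<lambda>f. f \<star> Ide K A)"


section \<open>Thick ideals and the noncommutative Balmer spectrum\<close>

text \<open>Full subcategories are identified with their sets of objects.\<close>

definition triangulated_subcategory :: "('o, 'm, 'z) tri_cat_scheme \<Rightarrow> 'o set \<Rightarrow> bool" where
  "triangulated_subcategory K I \<longleftrightarrow> I \<subseteq> Obj K \<and>
     (\<forall>Z. zero_object K Z \<longrightarrow> Z \<in> I) \<and>
     (\<forall>A B S. biproduct K A B S \<longrightarrow> A \<in> I \<longrightarrow> B \<in> I \<longrightarrow> S \<in> I) \<and>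
     (\<forall>A B. isomorphic K A B \<longrightarrow> A \<in> I \<longrightarrow> B \<in> I) \<and>
     (\<forall>A \<in> Obj K. A \<in> I \<longleftrightarrow> Shift K A \<in> I) \<and>
     (\<forall>A B C f g h. dist_triangle K A B C f g h \<longrightarrow>
        (A \<in> I \<longrightarrow> B \<in> I \<longrightarrow> C \<in> I) \<and> (B \<in> I \<longrightarrow> C \<in> I \<longrightarrow> A \<in> I) \<and>
        (A \<in> I \<longrightarrow> C \<in> I \<longrightarrow> B \<in> I))"

definition thick_ideal :: "('o, 'm, 'z) mon_tri_cat_scheme \<Rightarrow> 'o set \<Rightarrow> bool" where
  "thick_ideal K I \<longleftrightarrow> triangulated_subcategory K I \<and>
     (\<forall>A B S. biproduct K A B S \<longrightarrow> S \<in> I \<longrightarrow> A \<in> I \<and> B \<in> I) \<and>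
     (\<forall>A \<in> I. \<forall>B \<in> Obj K. A \<boxtimes>\<^bsub>K\<^esub> B \<in> I \<and> B \<boxtimes>\<^bsub>K\<^esub> A \<in> I)"

definition generated_ideal :: "('o, 'm, 'z) mon_tri_cat_scheme \<Rightarrow> 'o \<Rightarrow> 'o set" where
  "generated_ideal K A = \<Inter> {I. thick_ideal K I \<and> A \<in> I}"

definition ideal_tensor ::
  "('o, 'm, 'z) mon_tri_cat_scheme \<Rightarrow> 'o set \<Rightarrow> 'o set \<Rightarrow> 'o set" where
  "ideal_tensor K I J = {A \<boxtimes>\<^bsub>K\<^esub> B | A B. A \<in> I \<and> B \<in> J}"

definition prime_ideal :: "('o, 'm, 'z) mon_tri_cat_scheme \<Rightarrow> 'o set \<Rightarrow> bool" where
  "prime_ideal K P \<longleftrightarrow> thick_ideal K P \<and> P \<noteq> Obj K \<and>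
     (\<forall>I J. thick_ideal K I \<longrightarrow> thick_ideal K J \<longrightarrow> ideal_tensor K I J \<subseteq> P \<longrightarrow>
        I \<subseteq> P \<or> J \<subseteq> P)"

definition Spc :: "('o, 'm, 'z) mon_tri_cat_scheme \<Rightarrow> 'o set set" where
  "Spc K = {P. prime_ideal K P}"

definition Spc_closed :: "('o, 'm, 'z) mon_tri_cat_scheme \<Rightarrow> 'o set \<Rightarrow> 'o set set" where
  "Spc_closed K S = {P \<in> Spc K. P \<inter> S = {}}"

definition Spc_topology :: "('o, 'm, 'z) mon_tri_cat_scheme \<Rightarrow> 'o set topology" where
  "Spc_topology K = topology (\<lambda>U. \<exists>S \<subseteq> Obj K. U = Spc K - Spc_closed K S)"

definition V :: "('o, 'm, 'z) mon_tri_cat_scheme \<Rightarrow> 'o \<Rightarrow> 'o set set" where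
  "V K A = {P \<in> Spc K. A \<notin> P}"

text \<open>The sets \<^term>\<open>Spc_closed K S\<close> are indeed the closed sets of a topology.\<close>

context monoidal_triangulated_category
begin

lemma istopology_Spc: "istopology (\<lambda>U. \<exists>S \<subseteq> Obj K. U = Spc K - Spc_closed K S)"
  unfolding istopology_def
proof (intro conjI allI impI)
  fix U W
  assume "\<exists>S \<subseteq> Obj K. U = Spc K - Spc_closed K S" "\<exists>S \<subseteq> Obj K. W = Spc K - Spc_closed K S"
  then obtain S T where ST: "S \<subseteq> Obj K" "T \<subseteq> Obj K"
    "U = Spc K - Spc_closed K S" "W = Spc K - Spc_closed K T" by blast
  define R where "R = {Q. \<exists>A \<in> S. \<exists>B \<in> T. biproduct K A B Q}"
  have "R \<subseteq> Obj K" by (auto simp: R_def biproduct_def)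
  moreover have "P \<inter> R \<noteq> {} \<longleftrightarrow> P \<inter> S \<noteq> {} \<and> P \<inter> T \<noteq> {}" if "P \<in> Spc K" for P
  proof -
    have P: "thick_ideal K P" using that by (simp add: Spc_def prime_ideal_def)
    have summand: "\<forall>A B Q. biproduct K A B Q \<longrightarrow> Q \<in> P \<longrightarrow> A \<in> P \<and> B \<in> P"
      using P unfolding thick_ideal_def by (elim conjE)
    have "triangulated_subcategory K P" using P by (simp only: thick_ideal_def)
    then have "\<forall>A B Q. biproduct K A B Q \<longrightarrow> A \<in> P \<longrightarrow> B \<in> P \<longrightarrow> Q \<in> P"
      unfolding triangulated_subcategory_def by (elim conjE)
    with summand have sum: "biproduct K A B Q \<Longrightarrow> Q \<in> P \<longleftrightarrow> A \<in> P \<and> B \<in> P" for A B Q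
      by metis
    show ?thesis
    proof
      assume "P \<inter> R \<noteq> {}"
      then show "P \<inter> S \<noteq> {} \<and> P \<inter> T \<noteq> {}" using sum unfolding R_def by blast
    next
      assume "P \<inter> S \<noteq> {} \<and> P \<inter> T \<noteq> {}"
      then obtain A B where AB: "A \<in> P" "A \<in> S" "B \<in> P" "B \<in> T" by blast
      then obtain Q where "biproduct K A B Q" using ST ex_biproduct by blast
      then show "P \<inter> R \<noteq> {}" using AB sum unfolding R_def by blast
    qed
  qed
  then have "U \<inter> W = Spc K - Spc_closed K R"
    unfolding ST Spc_closed_def by blast
  ultimately show "\<exists>S \<subseteq> Obj K. U \<inter> W = Spc K - Spc_closed K S" by blast
next
  fix \<U>
  assume "\<forall>U \<in> \<U>. \<exists>S \<subseteq> Obj K. U = Spc K - Spc_closed K S"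
  then obtain S where S: "\<And>U. U \<in> \<U> \<Longrightarrow> S U \<subseteq> Obj K \<and> U = Spc K - Spc_closed K (S U)"
    by metis
  have "\<Union> \<U> = (\<Union>U \<in> \<U>. Spc K - Spc_closed K (S U))" using S by blast
  also have "\<dots> = Spc K - Spc_closed K (\<Union>U \<in> \<U>. S U)"
    unfolding Spc_closed_def by blast
  finally have "\<Union> \<U> = Spc K - Spc_closed K (\<Union>U \<in> \<U>. S U)" .
  moreover have "(\<Union>U \<in> \<U>. S U) \<subseteq> Obj K" using S by blast
  ultimately show "\<exists>S \<subseteq> Obj K. \<Union> \<U> = Spc K - Spc_closed K S" by blast
qed

lemma openin_Spc:
  "openin (Spc_topology K) U \<longleftrightarrow> (\<exists>S \<subseteq> Obj K. U = Spc K - Spc_closed K S)"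
  unfolding Spc_topology_def by (simp add: istopology_Spc)

lemma topspace_Spc: "topspace (Spc_topology K) = Spc K"
proof -
  obtain Z where Z: "zero_object K Z" using ex_zero_object by blast
  then have "Spc_closed K {Z} = {}"
    by (auto simp: Spc_closed_def Spc_def prime_ideal_def thick_ideal_def
        triangulated_subcategory_def)
  moreover have "{Z} \<subseteq> Obj K" using Z by (simp add: zero_object_def)
  ultimately have "openin (Spc_topology K) (Spc K)" unfolding openin_Spc by blast
  then have "Spc K \<subseteq> topspace (Spc_topology K)" by (rule openin_subset)
  moreover have "topspace (Spc_topology K) \<subseteq> Spc K"
    using openin_topspace[of "Spc_topology K"] unfolding openin_Spc by blast
  ultimately show ?thesis by blast
qed

lemma closedin_Spc:
  "closedin (Spc_topology K) C \<longleftrightarrow> (\<exists>S \<subseteq> Obj K. C = Spc_closed K S)"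
proof -
  have "Spc_closed K S \<subseteq> Spc K" for S unfolding Spc_closed_def by blast
  then show ?thesis
    unfolding closedin_def openin_Spc topspace_Spc by (metis double_diff order_refl)
qed

end


section \<open>Support data\<close>

definition Phi :: "('o \<Rightarrow> 'x set) \<Rightarrow> 'o set \<Rightarrow> 'x set" where
  "Phi \<sigma> S = (\<Union>A \<in> S. \<sigma> A)"

text \<open>The conditions common to support data and weak support data.  Values of \<open>\<sigma>\<close> outside
  \<^term>\<open>Obj K\<close> are irrelevant.\<close>

definition pre_support_datum ::
  "('o, 'm, 'z) mon_tri_cat_scheme \<Rightarrow> 'x topology \<Rightarrow> ('o \<Rightarrow> 'x set) \<Rightarrow> bool" where
  "pre_support_datum K X \<sigma> \<longleftrightarrow>
     (\<forall>A \<in> Obj K. \<sigma> A \<subseteq> topspace X) \<and>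
     (\<forall>Z. zero_object K Z \<longrightarrow> \<sigma> Z = {}) \<and> \<sigma> (Unit K) = topspace X \<and>
     (\<forall>A B S. biproduct K A B S \<longrightarrow> \<sigma> S = \<sigma> A \<union> \<sigma> B) \<and>
     (\<forall>A \<in> Obj K. \<sigma> (Shift K A) = \<sigma> A) \<and>
     (\<forall>A B C f g h. dist_triangle K A B C f g h \<longrightarrow> \<sigma> A \<subseteq> \<sigma> B \<union> \<sigma> C)"

definition support_datum ::
  "('o, 'm, 'z) mon_tri_cat_scheme \<Rightarrow> 'x topology \<Rightarrow> ('o \<Rightarrow> 'x set) \<Rightarrow> bool" where
  "support_datum K X \<sigma> \<longleftrightarrow> pre_support_datum K X \<sigma> \<and>
     (\<forall>A \<in> Obj K. \<forall>B \<in> Obj K. (\<Union>C \<in> Obj K. \<sigma> (A \<boxtimes>\<^bsub>K\<^esub> C \<boxtimes>\<^bsub>K\<^esub> B)) = \<sigma> A \<inter> \<sigma> B)"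

definition weak_support_datum ::
  "('o, 'm, 'z) mon_tri_cat_scheme \<Rightarrow> 'x topology \<Rightarrow> ('o \<Rightarrow> 'x set) \<Rightarrow> bool" where
  "weak_support_datum K X \<sigma> \<longleftrightarrow> pre_support_datum K X \<sigma> \<and>
     (\<forall>I J. thick_ideal K I \<longrightarrow> thick_ideal K J \<longrightarrow>
        Phi \<sigma> (ideal_tensor K I J) = Phi \<sigma> I \<inter> Phi \<sigma> J)"

end

theory Submission
  imports Defs
begin

text \<open>For a thick subcategory \<open>T\<close>, the objects \<open>A\<close> with \<open>C \<otimes> A \<otimes> D \<in> T\<close> for all \<open>C, D\<close> form
  the largest thick ideal inside \<open>T\<close>, because tensoring is exact.  Applied to
  \<open>T = {B. x \<notin> \<sigma> B}\<close> this gives the prime \<open>f\<^sub>\<sigma> x = {A. x \<notin> \<Phi>\<^sub>\<sigma> \<langle>A\<rangle>}\<close>; applied to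
  \<open>T = {X. X \<otimes> B \<in> P}\<close> and its mirror image it reduces primality of \<open>P\<close> to a condition on pairs
  of objects, which is what makes \<open>V\<close> a support datum.  Part (a) is a special case of part (b):
  every support datum is a weak one, with \<open>\<Phi>\<^sub>\<sigma> \<langle>A\<rangle> = \<sigma> A\<close>.\<close>

section \<open>Isomorphisms and additive functors\<close>

context category
begin

lemma Hom_Obj:
  assumes "f \<in> Hom K A B"
  shows "A \<in> Obj K" "B \<in> Obj K"
  using assms Dom_Obj Cod_Obj unfolding Hom_def by blast+

lemma isomorphic_sym: "isomorphic K A B \<Longrightarrow> isomorphic K B A"
  unfolding isomorphic_def iso_arr_def by blast

lemma isomorphic_trans:
  assumes "isomorphic K A B" "isomorphic K B C"
  shows "isomorphic K A C"
proof -
  obtain f f' where f: "f \<in> Hom K A B" "f' \<in> Hom K B A" "f' \<cdot> f = Ide K A" "f \<cdot> f' = Ide K B"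
    using assms(1) unfolding isomorphic_def iso_arr_def by blast
  obtain g g' where g: "g \<in> Hom K B C" "g' \<in> Hom K C B" "g' \<cdot> g = Ide K B" "g \<cdot> g' = Ide K C"
    using assms(2) unfolding isomorphic_def iso_arr_def by blast
  have "(f' \<cdot> g') \<cdot> (g \<cdot> f) = f' \<cdot> ((g' \<cdot> g) \<cdot> f)"
    using Comp_assoc[OF Comp_Hom[OF f(1) g(1)] g(2) f(2)] Comp_assoc[OF f(1) g(1,2)] by simp
  then have 1: "(f' \<cdot> g') \<cdot> (g \<cdot> f) = Ide K A" using f g Ide_Comp by metis
  have "(g \<cdot> f) \<cdot> (f' \<cdot> g') = g \<cdot> ((f \<cdot> f') \<cdot> g')"
    using Comp_assoc[OF Comp_Hom[OF g(2) f(2)] f(1) g(1)] Comp_assoc[OF g(2) f(2,1)] by simp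
  then have 2: "(g \<cdot> f) \<cdot> (f' \<cdot> g') = Ide K C" using f g Ide_Comp by metis
  show ?thesis
    using assms 1 2 Comp_Hom[OF f(1) g(1)] Comp_Hom[OF g(2) f(2)]
    unfolding isomorphic_def iso_arr_def by blast
qed

lemma endofunctor_isomorphic:
  assumes F: "endofunctor K F\<^sub>o F\<^sub>m" and iso: "isomorphic K A B"
  shows "isomorphic K (F\<^sub>o A) (F\<^sub>o B)"
proof -
  obtain f g where f: "f \<in> Hom K A B" and g: "g \<in> Hom K B A"
    and inv: "g \<cdot> f = Ide K A" "f \<cdot> g = Ide K B"
    using iso unfolding isomorphic_def iso_arr_def by blast
  have AB: "A \<in> Obj K" "B \<in> Obj K" using iso by (auto simp: isomorphic_def)
  have "F\<^sub>m g \<cdot> F\<^sub>m f = Ide K (F\<^sub>o A)" "F\<^sub>m f \<cdot> F\<^sub>m g = Ide K (F\<^sub>o B)"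
    "F\<^sub>m f \<in> Hom K (F\<^sub>o A) (F\<^sub>o B)" "F\<^sub>m g \<in> Hom K (F\<^sub>o B) (F\<^sub>o A)" "F\<^sub>o A \<in> Obj K" "F\<^sub>o B \<in> Obj K"
    using F f g inv AB unfolding endofunctor_def by metis+
  then show ?thesis unfolding isomorphic_def iso_arr_def by blast
qed

end

context additive_category
begin

section \<open>Zero arrows and what additive functors preserve\<close>

lemma Zero_Hom: "A \<in> Obj K \<Longrightarrow> B \<in> Obj K \<Longrightarrow> Zero K A B \<in> Hom K A B"
  using monoid.one_closed[of "Hom_group K A B"] Hom_comm_group[of A B]
  by (simp add: Hom_group_def comm_group_def group_def)

lemma Add_Zero: "f \<in> Hom K A B \<Longrightarrow> f \<boxplus> Zero K A B = f"
  using monoid.r_one[of "Hom_group K A B" f] Hom_comm_group[of A B] Hom_Obj[of f A B]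
  by (simp add: Hom_group_def comm_group_def group_def)

text \<open>Cancellation in the group \<open>Hom_group K A B\<close>. \<open>Zero_Comp\<close>,
  \<open>Comp_Zero\<close> and \<open>additive_endofunctor_Zero\<close> rest on it: an additive
  operation sends zero to an arrow that is its own double.\<close>

lemma Add_idem_Zero:
  assumes "f \<in> Hom K A B" "f \<boxplus> f = f"
  shows "f = Zero K A B"
proof -
  interpret G: comm_group "Hom_group K A B"
    using Hom_comm_group Hom_Obj[OF assms(1)] by blast
  show ?thesis using G.l_cancel_one[of f f] assms by (simp add: Hom_group_def)
qed

lemma Zero_Comp:
  assumes "f \<in> Hom K A B" "C \<in> Obj K"
  shows "Zero K B C \<cdot> f = Zero K A C"
proof -
  have Z: "Zero K B C \<in> Hom K B C" using Zero_Hom Hom_Obj assms by blast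
  then have "(Zero K B C \<cdot> f) \<boxplus> (Zero K B C \<cdot> f) = Zero K B C \<cdot> f"
    using Comp_Add_left[OF assms(1) Z Z] Add_Zero[OF Z] by simp
  then show ?thesis using Add_idem_Zero Comp_Hom[OF assms(1) Z] by blast
qed

lemma Comp_Zero:
  assumes "f \<in> Hom K B C" "A \<in> Obj K"
  shows "f \<cdot> Zero K A B = Zero K A C"
proof -
  have Z: "Zero K A B \<in> Hom K A B" using Zero_Hom Hom_Obj assms by blast
  then have "(f \<cdot> Zero K A B) \<boxplus> (f \<cdot> Zero K A B) = f \<cdot> Zero K A B"
    using Comp_Add_right[OF Z Z assms(1)] Add_Zero[OF Z] by simp
  then show ?thesis using Add_idem_Zero Comp_Hom[OF Z assms(1)] by blast
qed

text \<open>If the identity of \<open>Z\<close> is zero, composing with it shows that every arrow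
  into or out of \<open>Z\<close> is zero. The right side is an equation between arrows, which
  additive functors preserve.\<close>

lemma zero_object_iff: "zero_object K Z \<longleftrightarrow> Z \<in> Obj K \<and> Ide K Z = Zero K Z Z"
proof
  assume "zero_object K Z"
  then show "Z \<in> Obj K \<and> Ide K Z = Zero K Z Z"
    unfolding zero_object_def using Ide_Hom[of Z] Zero_Hom[of Z Z] by blast
next
  assume Z: "Z \<in> Obj K \<and> Ide K Z = Zero K Z Z"
  have "f = Zero K A Z" if "f \<in> Hom K A Z" for f A
    using Ide_Comp[OF that] Zero_Comp[OF that] Z by metis
  moreover have "f = Zero K Z A" if "f \<in> Hom K Z A" for f A
    using Comp_Ide[OF that] Comp_Zero[OF that] Z by metis
  ultimately show "zero_object K Z"
    unfolding zero_object_def using Z Zero_Hom by metis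
qed

text \<open>The mutually inverse arrows \<open>u\<close> and \<open>v\<close> are the inclusion and
  projection for \<open>A\<close>; those for \<open>Z\<close> are zero.\<close>

lemma isomorphic_biproduct:
  assumes "isomorphic K A B" "zero_object K Z"
  shows "biproduct K A Z B"
proof -
  obtain u v where u: "u \<in> Hom K A B" and v: "v \<in> Hom K B A"
    and inv: "v \<cdot> u = Ide K A" "u \<cdot> v = Ide K B"
    using assms(1) unfolding isomorphic_def iso_arr_def by blast
  have AB: "A \<in> Obj K" "B \<in> Obj K" using assms(1) by (auto simp: isomorphic_def)
  have Z: "Z \<in> Obj K" "Ide K Z = Zero K Z Z" using assms(2) zero_object_iff by auto
  have jq: "Zero K Z B \<in> Hom K Z B" "Zero K B Z \<in> Hom K B Z" using Zero_Hom AB Z by auto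
  have "(u \<cdot> v) \<boxplus> (Zero K Z B \<cdot> Zero K B Z) = Ide K B"
    using inv Zero_Comp[OF jq(2) AB(2)] Add_Zero[OF Ide_Hom[OF AB(2)]] by simp
  moreover have "Zero K B Z \<cdot> Zero K Z B = Ide K Z" "v \<cdot> Zero K Z B = Zero K Z A"
    "Zero K B Z \<cdot> u = Zero K A Z"
    using Zero_Comp[OF jq(1) Z(1)] Z Comp_Zero[OF v Z(1)] Zero_Comp[OF u Z(1)] by simp_all
  ultimately show ?thesis
    unfolding biproduct_def using AB Z(1) u v inv jq by blast
qed

lemma additive_endofunctor_Zero:
  assumes F: "additive_endofunctor K F\<^sub>o F\<^sub>m" and AB: "A \<in> Obj K" "B \<in> Obj K"
  shows "F\<^sub>m (Zero K A B) = Zero K (F\<^sub>o A) (F\<^sub>o B)"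
proof -
  have Z: "Zero K A B \<in> Hom K A B" using Zero_Hom AB by blast
  then have "F\<^sub>m (Zero K A B) \<boxplus> F\<^sub>m (Zero K A B) = F\<^sub>m (Zero K A B)"
    using F Add_Zero[OF Z] unfolding additive_endofunctor_def by metis
  moreover have "F\<^sub>m (Zero K A B) \<in> Hom K (F\<^sub>o A) (F\<^sub>o B)"
    using F Z unfolding additive_endofunctor_def endofunctor_def by blast
  ultimately show ?thesis using Add_idem_Zero by blast
qed

lemma additive_endofunctor_zero_object:
  assumes F: "additive_endofunctor K F\<^sub>o F\<^sub>m" and Z: "zero_object K Z"
  shows "zero_object K (F\<^sub>o Z)"
proof -
  have "Z \<in> Obj K" "Ide K Z = Zero K Z Z" using Z zero_object_iff by auto
  moreover from this have "F\<^sub>o Z \<in> Obj K" "F\<^sub>m (Ide K Z) = Ide K (F\<^sub>o Z)"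
    using F unfolding additive_endofunctor_def endofunctor_def by auto
  ultimately show ?thesis
    using additive_endofunctor_Zero[OF F, of Z Z] by (simp add: zero_object_iff)
qed

text \<open>A direct sum is given by equations in composition, addition, identities and zeros, all
  of which the functor respects.\<close>

lemma additive_endofunctor_biproduct:
  assumes F: "additive_endofunctor K F\<^sub>o F\<^sub>m" and S: "biproduct K A B S"
  shows "biproduct K (F\<^sub>o A) (F\<^sub>o B) (F\<^sub>o S)"
proof -
  obtain i j p q where
    h: "i \<in> Hom K A S" "j \<in> Hom K B S" "p \<in> Hom K S A" "q \<in> Hom K S B"
    and e: "p \<cdot> i = Ide K A" "q \<cdot> j = Ide K B" "p \<cdot> j = Zero K B A" "q \<cdot> i = Zero K A B"
      "(i \<cdot> p) \<boxplus> (j \<cdot> q) = Ide K S"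
    and O: "A \<in> Obj K" "B \<in> Obj K" "S \<in> Obj K"
    using S unfolding biproduct_def by blast
  have F_Obj: "F\<^sub>o X \<in> Obj K" "F\<^sub>m (Ide K X) = Ide K (F\<^sub>o X)" if "X \<in> Obj K" for X
    using F that unfolding additive_endofunctor_def endofunctor_def by auto
  have F_Hom: "F\<^sub>m f \<in> Hom K (F\<^sub>o X) (F\<^sub>o Y)" if "f \<in> Hom K X Y" for f X Y
    using F that unfolding additive_endofunctor_def endofunctor_def by auto
  have F_Comp: "F\<^sub>m (g \<cdot> f) = F\<^sub>m g \<cdot> F\<^sub>m f" if "f \<in> Hom K X Y" "g \<in> Hom K Y W" for f g X Y W
    using F that unfolding additive_endofunctor_def endofunctor_def by metis
  have "F\<^sub>m ((i \<cdot> p) \<boxplus> (j \<cdot> q)) = F\<^sub>m (i \<cdot> p) \<boxplus> F\<^sub>m (j \<cdot> q)"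
    using F Comp_Hom[OF h(3,1)] Comp_Hom[OF h(4,2)] unfolding additive_endofunctor_def by blast
  then have "(F\<^sub>m i \<cdot> F\<^sub>m p) \<boxplus> (F\<^sub>m j \<cdot> F\<^sub>m q) = Ide K (F\<^sub>o S)"
    using F_Comp[OF h(3,1)] F_Comp[OF h(4,2)] e(5) F_Obj(2)[OF O(3)] by simp
  moreover have "F\<^sub>m p \<cdot> F\<^sub>m i = Ide K (F\<^sub>o A)" "F\<^sub>m q \<cdot> F\<^sub>m j = Ide K (F\<^sub>o B)"
    using F_Comp[OF h(1,3)] F_Comp[OF h(2,4)] e(1,2) F_Obj(2) O by simp_all
  moreover have "F\<^sub>m p \<cdot> F\<^sub>m j = Zero K (F\<^sub>o B) (F\<^sub>o A)" "F\<^sub>m q \<cdot> F\<^sub>m i = Zero K (F\<^sub>o A) (F\<^sub>o B)"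
    using F_Comp[OF h(2,3)] F_Comp[OF h(1,4)] e(3,4) additive_endofunctor_Zero[OF F] O by simp_all
  ultimately show ?thesis
    unfolding biproduct_def using F_Obj(1) O F_Hom h by blast
qed

end


section \<open>Thick subcategories\<close>

text \<open>This is \<open>thick_ideal\<close> without its tensor clause. The objects whose support
  misses a given point have this property for every \<open>pre_support_datum\<close>, while being an
  ideal takes more.\<close>

definition thick_subcategory :: "('o, 'm, 'z) tri_cat_scheme \<Rightarrow> 'o set \<Rightarrow> bool" where
  "thick_subcategory K T \<longleftrightarrow> triangulated_subcategory K T \<and>
     (\<forall>A B S. biproduct K A B S \<longrightarrow> S \<in> T \<longrightarrow> A \<in> T \<and> B \<in> T)"

lemma thick_subcategoryD:
  assumes "thick_subcategory K T"
  shows "A \<in> T \<Longrightarrow> A \<in> Obj K"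
    and "zero_object K Z \<Longrightarrow> Z \<in> T"
    and "biproduct K A B S \<Longrightarrow> S \<in> T \<longleftrightarrow> A \<in> T \<and> B \<in> T"
    and "isomorphic K A B \<Longrightarrow> A \<in> T \<Longrightarrow> B \<in> T"
    and "A \<in> Obj K \<Longrightarrow> Shift K A \<in> T \<longleftrightarrow> A \<in> T"
    and "dist_triangle K A B C f g h \<Longrightarrow> A \<in> T \<Longrightarrow> B \<in> T \<Longrightarrow> C \<in> T"
    and "dist_triangle K A B C f g h \<Longrightarrow> B \<in> T \<Longrightarrow> C \<in> T \<Longrightarrow> A \<in> T"
    and "dist_triangle K A B C f g h \<Longrightarrow> A \<in> T \<Longrightarrow> C \<in> T \<Longrightarrow> B \<in> T"
proof -
  have T: "triangulated_subcategory K T" using assms by (simp add: thick_subcategory_def)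
  show "A \<in> T \<Longrightarrow> A \<in> Obj K" "zero_object K Z \<Longrightarrow> Z \<in> T"
    "isomorphic K A B \<Longrightarrow> A \<in> T \<Longrightarrow> B \<in> T" "A \<in> Obj K \<Longrightarrow> Shift K A \<in> T \<longleftrightarrow> A \<in> T"
    "dist_triangle K A B C f g h \<Longrightarrow> A \<in> T \<Longrightarrow> B \<in> T \<Longrightarrow> C \<in> T"
    "dist_triangle K A B C f g h \<Longrightarrow> B \<in> T \<Longrightarrow> C \<in> T \<Longrightarrow> A \<in> T"
    "dist_triangle K A B C f g h \<Longrightarrow> A \<in> T \<Longrightarrow> C \<in> T \<Longrightarrow> B \<in> T"
    using T unfolding triangulated_subcategory_def by (elim conjE; blast)+
  have "biproduct K A B S \<Longrightarrow> A \<in> T \<Longrightarrow> B \<in> T \<Longrightarrow> S \<in> T"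
    using T unfolding triangulated_subcategory_def by (elim conjE; blast)
  moreover have "biproduct K A B S \<Longrightarrow> S \<in> T \<Longrightarrow> A \<in> T \<and> B \<in> T"
    using assms unfolding thick_subcategory_def by (elim conjE; blast)
  ultimately show "biproduct K A B S \<Longrightarrow> S \<in> T \<longleftrightarrow> A \<in> T \<and> B \<in> T" by blast
qed

lemma thick_ideal_iff:
  "thick_ideal K I \<longleftrightarrow> thick_subcategory K I \<and>
     (\<forall>A \<in> I. \<forall>B \<in> Obj K. Tensor K A B \<in> I \<and> Tensor K B A \<in> I)"
  unfolding thick_ideal_def thick_subcategory_def by blast

context triangulated_category
begin

lemma dist_triangle_Obj:
  assumes "dist_triangle K A B C f g h"
  shows "A \<in> Obj K" "B \<in> Obj K" "C \<in> Obj K"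
  using assms Hom_Obj unfolding dist_triangle_def triangle_def by blast+

lemma dist_triangle_rotate:
  assumes "dist_triangle K A B C f g h"
  shows "dist_triangle K B C (Shift K A) g h (neg_arr K (Shift_map K f))"
  using assms Tri_rotate unfolding dist_triangle_def by blast

lemma Shift_Obj: "A \<in> Obj K \<Longrightarrow> Shift K A \<in> Obj K"
  using Shift_additive unfolding additive_endofunctor_def endofunctor_def by blast

text \<open>Rotation makes the other two closure properties for triangles redundant, and closure under
  isomorphism holds because \<open>A \<cong> B\<close> makes \<open>B\<close> a direct sum of \<open>A\<close> and \<open>0\<close>.\<close>

lemma thick_subcategoryI:
  assumes sub: "T \<subseteq> Obj K"
    and zero: "\<And>Z. zero_object K Z \<Longrightarrow> Z \<in> T"
    and sum: "\<And>A B S. biproduct K A B S \<Longrightarrow> S \<in> T \<longleftrightarrow> A \<in> T \<and> B \<in> T"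
    and shift: "\<And>A. A \<in> Obj K \<Longrightarrow> Shift K A \<in> T \<longleftrightarrow> A \<in> T"
    and tri: "\<And>A B C f g h. dist_triangle K A B C f g h \<Longrightarrow> B \<in> T \<Longrightarrow> C \<in> T \<Longrightarrow> A \<in> T"
  shows "thick_subcategory K T"
proof -
  have iso: "B \<in> T" if "isomorphic K A B" "A \<in> T" for A B
    using isomorphic_biproduct[OF that(1)] ex_zero_object sum zero that(2) by metis
  have tri2: "B \<in> T" if "dist_triangle K A B C f g h" "A \<in> T" "C \<in> T" for A B C f g h
    using tri[OF dist_triangle_rotate[OF that(1)]] shift dist_triangle_Obj[OF that(1)] that by blast
  have tri3: "C \<in> T" if "dist_triangle K A B C f g h" "A \<in> T" "B \<in> T" for A B C f g h
    using tri2[OF dist_triangle_rotate[OF that(1)]] shift dist_triangle_Obj[OF that(1)] that by blast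
  show ?thesis
    unfolding thick_subcategory_def triangulated_subcategory_def
    by (intro conjI allI impI ballI)
      (rule sub | erule zero | erule (1) iso | erule shift[symmetric] |
        erule (2) tri tri2 tri3 | use sum in blast)+
qed

lemma thick_subcategory_Obj: "thick_subcategory K (Obj K)"
  by (rule thick_subcategoryI)
    (auto simp: zero_object_def biproduct_def Shift_Obj dest: dist_triangle_Obj)

text \<open>Every closure property passes to intersections. A nonempty family keeps the result
  inside \<open>Obj K\<close>; the empty intersection would be the whole type.\<close>

lemma thick_subcategory_Inter:
  assumes "\<T> \<noteq> {}" "\<And>T. T \<in> \<T> \<Longrightarrow> thick_subcategory K T"
  shows "thick_subcategory K (\<Inter>\<T>)"
proof (rule thick_subcategoryI)
  obtain T where T: "T \<in> \<T>" using assms(1) by blast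
  show "\<Inter>\<T> \<subseteq> Obj K"
  proof
    fix A assume "A \<in> \<Inter>\<T>"
    then have "A \<in> T" using T by blast
    then show "A \<in> Obj K" by (rule thick_subcategoryD(1)[OF assms(2)[OF T]])
  qed
next
  fix Z assume Z: "zero_object K Z"
  show "Z \<in> \<Inter>\<T>" using thick_subcategoryD(2)[OF assms(2) Z] by blast
next
  fix A B S assume S: "biproduct K A B S"
  show "S \<in> \<Inter>\<T> \<longleftrightarrow> A \<in> \<Inter>\<T> \<and> B \<in> \<Inter>\<T>"
    using thick_subcategoryD(3)[OF assms(2) S] by blast
next
  fix A assume A: "A \<in> Obj K"
  show "Shift K A \<in> \<Inter>\<T> \<longleftrightarrow> A \<in> \<Inter>\<T>" using thick_subcategoryD(5)[OF assms(2) A] by blast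
next
  fix A B C f g h assume t: "dist_triangle K A B C f g h" and "B \<in> \<Inter>\<T>" "C \<in> \<Inter>\<T>"
  then show "A \<in> \<Inter>\<T>" using thick_subcategoryD(7)[OF assms(2) t] by blast
qed

text \<open>An exact functor carries zero objects, direct sums and distinguished triangles to the
  same kind of data, so each closure property of \<open>T\<close> pulls back.\<close>

lemma thick_subcategory_preimage:
  assumes F: "exact_endofunctor K F\<^sub>o F\<^sub>m" and T: "thick_subcategory K T"
  shows "thick_subcategory K {A \<in> Obj K. F\<^sub>o A \<in> T}"
proof -
  have add: "additive_endofunctor K F\<^sub>o F\<^sub>m" using F by (simp add: exact_endofunctor_def)
  obtain \<theta> where iso: "\<And>A. A \<in> Obj K \<Longrightarrow> iso_arr K (F\<^sub>o (Shift K A)) (Shift K (F\<^sub>o A)) (\<theta> A)"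
    and tri: "\<And>A B C f g h. dist_triangle K A B C f g h \<Longrightarrow>
      dist_triangle K (F\<^sub>o A) (F\<^sub>o B) (F\<^sub>o C) (F\<^sub>m f) (F\<^sub>m g) (\<theta> A \<cdot> F\<^sub>m h)"
    using F unfolding exact_endofunctor_def by (elim conjE exE) blast
  have F_Obj: "F\<^sub>o A \<in> Obj K" if "A \<in> Obj K" for A
    using add that unfolding additive_endofunctor_def endofunctor_def by auto
  show ?thesis
  proof (rule thick_subcategoryI)
    fix Z assume "zero_object K Z"
    then show "Z \<in> {A \<in> Obj K. F\<^sub>o A \<in> T}"
      using thick_subcategoryD(2)[OF T additive_endofunctor_zero_object[OF add]]
      by (simp add: zero_object_def)
  next
    fix A B S assume S: "biproduct K A B S"
    then show "S \<in> {A \<in> Obj K. F\<^sub>o A \<in> T} \<longleftrightarrow> A \<in> {A \<in> Obj K. F\<^sub>o A \<in> T} \<and> B \<in> {A \<in> Obj K. F\<^sub>o A \<in> T}"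
      using thick_subcategoryD(3)[OF T additive_endofunctor_biproduct[OF add S]]
      by (auto simp: biproduct_def)
  next
    fix A assume A: "A \<in> Obj K"
    \<comment> \<open>The functor commutes with the shift only up to \<open>\<theta>\<close>, so
      closure of \<open>T\<close> under isomorphism enters here.\<close>
    have "isomorphic K (F\<^sub>o (Shift K A)) (Shift K (F\<^sub>o A))"
      unfolding isomorphic_def using iso[OF A] F_Obj Shift_Obj A by blast
    then have "F\<^sub>o (Shift K A) \<in> T \<longleftrightarrow> Shift K (F\<^sub>o A) \<in> T"
      using thick_subcategoryD(4)[OF T] isomorphic_sym by blast
    then show "Shift K A \<in> {A \<in> Obj K. F\<^sub>o A \<in> T} \<longleftrightarrow> A \<in> {A \<in> Obj K. F\<^sub>o A \<in> T}"
      using thick_subcategoryD(5)[OF T F_Obj[OF A]] Shift_Obj A by simp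
  next
    fix A B C f g h
    assume "dist_triangle K A B C f g h" "B \<in> {A \<in> Obj K. F\<^sub>o A \<in> T}" "C \<in> {A \<in> Obj K. F\<^sub>o A \<in> T}"
    then show "A \<in> {A \<in> Obj K. F\<^sub>o A \<in> T}"
      using thick_subcategoryD(7)[OF T tri] dist_triangle_Obj(1) by blast
  qed simp
qed

end


section \<open>The largest thick ideal in a thick subcategory\<close>

text \<open>Without a braiding, factors on both sides are required. The product is bracketed as
  \<open>(C \<boxtimes> A) \<boxtimes> D\<close>, which accounts for the associators below.\<close>

definition ideal_core :: "('o, 'm, 'z) mon_tri_cat_scheme \<Rightarrow> 'o set \<Rightarrow> 'o set" where
  "ideal_core K T = {A \<in> Obj K. \<forall>C \<in> Obj K. \<forall>D \<in> Obj K. C \<boxtimes>\<^bsub>K\<^esub> A \<boxtimes>\<^bsub>K\<^esub> D \<in> T}"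

context monoidal_triangulated_category
begin

section \<open>Tensor products up to isomorphism\<close>

lemma Assoc_isomorphic:
  assumes "A \<in> Obj K" "B \<in> Obj K" "C \<in> Obj K"
  shows "isomorphic K (A \<boxtimes> B \<boxtimes> C) (A \<boxtimes> (B \<boxtimes> C))"
  unfolding isomorphic_def using Assoc_iso[OF assms] by (auto intro: Tensor_Obj assms)

lemma Lunit_isomorphic: "A \<in> Obj K \<Longrightarrow> isomorphic K (Unit K \<boxtimes> A) A"
  unfolding isomorphic_def using Lunit_iso[of A] by (auto intro: Tensor_Obj Unit_Obj)

lemma Runit_isomorphic: "A \<in> Obj K \<Longrightarrow> isomorphic K (A \<boxtimes> Unit K) A"
  unfolding isomorphic_def using Runit_iso[of A] by (auto intro: Tensor_Obj Unit_Obj)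

lemma Tensor_isomorphic_left:
  "isomorphic K A B \<Longrightarrow> C \<in> Obj K \<Longrightarrow> isomorphic K (A \<boxtimes> C) (B \<boxtimes> C)"
  using endofunctor_isomorphic[of "\<lambda>X. X \<boxtimes> C"] Tensor_right_exact[of C]
  unfolding exact_endofunctor_def additive_endofunctor_def by blast

lemma Tensor_isomorphic_right:
  "isomorphic K A B \<Longrightarrow> C \<in> Obj K \<Longrightarrow> isomorphic K (C \<boxtimes> A) (C \<boxtimes> B)"
  using endofunctor_isomorphic[of "\<lambda>X. C \<boxtimes> X"] Tensor_left_exact[of C]
  unfolding exact_endofunctor_def additive_endofunctor_def by blast

lemma Unit_sandwich:
  assumes "A \<in> Obj K"
  shows "isomorphic K (Unit K \<boxtimes> A \<boxtimes> Unit K) A"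
  by (rule isomorphic_trans[OF Runit_isomorphic Lunit_isomorphic]) (intro Tensor_Obj Unit_Obj assms)+

lemma thick_subcategory_cong:
  assumes "thick_subcategory K T" "isomorphic K A B"
  shows "A \<in> T \<longleftrightarrow> B \<in> T"
  using thick_subcategoryD(4)[OF assms(1)] assms(2) isomorphic_sym by blast

lemma thick_subcategory_Tensor_preimage:
  assumes "thick_subcategory K T" "B \<in> Obj K"
  shows "thick_subcategory K {A \<in> Obj K. A \<boxtimes> B \<in> T}"
    and "thick_subcategory K {A \<in> Obj K. B \<boxtimes> A \<in> T}"
  by (rule thick_subcategory_preimage[OF Tensor_right_exact] thick_subcategory_preimage[OF Tensor_left_exact];
      rule assms)+

text \<open>Thickness: the core is an intersection of preimages of \<open>T\<close> under the exact
  functors \<open>A \<mapsto> C \<boxtimes> A \<boxtimes> D\<close>. Ideal property: a new factor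
  \<open>B\<close> is absorbed into \<open>D\<close> or into \<open>C\<close>.\<close>

lemma thick_ideal_core:
  assumes T: "thick_subcategory K T"
  shows "thick_ideal K (ideal_core K T)"
  unfolding thick_ideal_iff
proof (intro conjI ballI)
  \<comment> \<open>The two-sided preimage is written as a preimage of a preimage, so that exactness
    in one variable is applied twice.\<close>
  define pre where "pre = (\<lambda>(C, D). {A \<in> Obj K. C \<boxtimes> A \<in> {B \<in> Obj K. B \<boxtimes> D \<in> T}})"
  have "ideal_core K T = \<Inter>(pre ` (Obj K \<times> Obj K))"
    unfolding ideal_core_def pre_def using Unit_Obj by (auto simp: Tensor_Obj)
  moreover have "thick_subcategory K S" if S: "S \<in> pre ` (Obj K \<times> Obj K)" for S
  proof -
    obtain C D where CD: "C \<in> Obj K" "D \<in> Obj K" "S = pre (C, D)" using S by blast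
    show ?thesis
      using thick_subcategory_Tensor_preimage(2)[OF
          thick_subcategory_Tensor_preimage(1)[OF T CD(2)] CD(1)] CD(3)
      unfolding pre_def by simp
  qed
  moreover have "pre ` (Obj K \<times> Obj K) \<noteq> {}" using Unit_Obj by blast
  ultimately show "thick_subcategory K (ideal_core K T)" using thick_subcategory_Inter by metis
next
  fix A B assume A: "A \<in> ideal_core K T" and B: "B \<in> Obj K"
  have A_Obj: "A \<in> Obj K" and AT: "\<And>C D. C \<in> Obj K \<Longrightarrow> D \<in> Obj K \<Longrightarrow> C \<boxtimes> A \<boxtimes> D \<in> T"
    using A by (auto simp: ideal_core_def)
  show "A \<boxtimes> B \<in> ideal_core K T"
    unfolding ideal_core_def
  proof (intro CollectI conjI ballI)
    fix C D assume C: "C \<in> Obj K" and D: "D \<in> Obj K"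
    have "isomorphic K (C \<boxtimes> A \<boxtimes> B \<boxtimes> D) (C \<boxtimes> (A \<boxtimes> B) \<boxtimes> D)"
      by (intro Tensor_isomorphic_left Assoc_isomorphic A_Obj B C D)
    moreover have "isomorphic K (C \<boxtimes> A \<boxtimes> B \<boxtimes> D) (C \<boxtimes> A \<boxtimes> (B \<boxtimes> D))"
      by (intro Assoc_isomorphic Tensor_Obj A_Obj B C D)
    ultimately show "C \<boxtimes> (A \<boxtimes> B) \<boxtimes> D \<in> T"
      using thick_subcategory_cong[OF T] AT[OF C Tensor_Obj[OF B D]] by blast
  qed (intro Tensor_Obj A_Obj B)
  show "B \<boxtimes> A \<in> ideal_core K T"
    unfolding ideal_core_def
  proof (intro CollectI conjI ballI)
    fix C D assume C: "C \<in> Obj K" and D: "D \<in> Obj K"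
    have "isomorphic K (C \<boxtimes> B \<boxtimes> A \<boxtimes> D) (C \<boxtimes> (B \<boxtimes> A) \<boxtimes> D)"
      by (intro Tensor_isomorphic_left Assoc_isomorphic A_Obj B C D)
    then show "C \<boxtimes> (B \<boxtimes> A) \<boxtimes> D \<in> T"
      using thick_subcategory_cong[OF T] AT[OF Tensor_Obj[OF C B] D] by blast
  qed (intro Tensor_Obj A_Obj B)
qed

text \<open>Take \<open>C\<close> and \<open>D\<close> to be the unit and remove them by
  \<open>Unit_sandwich\<close>.\<close>

lemma ideal_core_subset:
  assumes "thick_subcategory K T"
  shows "ideal_core K T \<subseteq> T"
  using thick_subcategory_cong[OF assms Unit_sandwich] Unit_Obj unfolding ideal_core_def by blast

lemma thick_idealD:
  assumes "thick_ideal K I"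
  shows "thick_subcategory K I"
    and "A \<in> I \<Longrightarrow> A \<in> Obj K"
    and "A \<in> I \<Longrightarrow> B \<in> Obj K \<Longrightarrow> A \<boxtimes> B \<in> I"
    and "A \<in> I \<Longrightarrow> B \<in> Obj K \<Longrightarrow> B \<boxtimes> A \<in> I"
proof -
  show "thick_subcategory K I" using assms by (simp add: thick_ideal_iff)
  then show "A \<in> I \<Longrightarrow> A \<in> Obj K" by (rule thick_subcategoryD(1))
  show "A \<in> I \<Longrightarrow> B \<in> Obj K \<Longrightarrow> A \<boxtimes> B \<in> I" "A \<in> I \<Longrightarrow> B \<in> Obj K \<Longrightarrow> B \<boxtimes> A \<in> I"
    using assms by (simp_all add: thick_ideal_iff)
qed

lemma thick_ideal_subset_core:
  assumes "thick_ideal K I" "I \<subseteq> T"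
  shows "I \<subseteq> ideal_core K T"
  using thick_idealD(2-4)[OF assms(1)] assms(2) unfolding ideal_core_def by auto

section \<open>Generated ideals and products of them\<close>

lemma thick_ideal_generated:
  assumes "A \<in> Obj K"
  shows "thick_ideal K (generated_ideal K A)"
proof -
  \<comment> \<open>For \<open>A \<in> Obj K\<close> this ideal is a member of the family being
    intersected, which is therefore nonempty.\<close>
  have "thick_ideal K (Obj K)" using thick_subcategory_Obj Tensor_Obj by (simp add: thick_ideal_iff)
  then have "thick_subcategory K (generated_ideal K A)"
    unfolding generated_ideal_def
    using assms by (intro thick_subcategory_Inter) (auto intro: thick_idealD(1))
  then show ?thesis
    unfolding thick_ideal_iff by (auto simp: generated_ideal_def intro: thick_idealD(3,4))
qed

lemma generated_ideal_contains: "A \<in> generated_ideal K A"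
  unfolding generated_ideal_def by blast

lemma generated_ideal_subset_iff:
  "thick_ideal K I \<Longrightarrow> generated_ideal K A \<subseteq> I \<longleftrightarrow> A \<in> I"
  unfolding generated_ideal_def by blast

text \<open>This replaces an induction over the generated ideal: a property of objects that is
  merely thick spreads from \<open>A\<close> to the whole ideal once it holds for all
  \<open>C \<boxtimes> A \<boxtimes> D\<close>.\<close>

lemma generated_ideal_subset_iff_core:
  assumes "A \<in> Obj K" "thick_subcategory K T"
  shows "generated_ideal K A \<subseteq> T \<longleftrightarrow> A \<in> ideal_core K T"
  using generated_ideal_subset_iff[OF thick_ideal_core[OF assms(2)], of A]
    ideal_core_subset[OF assms(2)] thick_ideal_subset_core[OF thick_ideal_generated[OF assms(1)]]
  by blast

text \<open>The two generators are enlarged one after the other. With \<open>B\<close> fixed,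
  \<open>X \<boxtimes> B \<in> P\<close> spreads from \<open>A\<close> to all \<open>X\<close> in
  its ideal; then, with such an \<open>X\<close> fixed, \<open>X \<boxtimes> Y \<in> P\<close>
  spreads from \<open>B\<close> to all \<open>Y\<close> in its ideal.\<close>

lemma generated_ideal_tensor_subset:
  assumes P: "thick_ideal K P" and A: "A \<in> Obj K" and B: "B \<in> Obj K"
    and ACB: "\<And>C. C \<in> Obj K \<Longrightarrow> A \<boxtimes> C \<boxtimes> B \<in> P"
  shows "ideal_tensor K (generated_ideal K A) (generated_ideal K B) \<subseteq> P"
proof -
  note thP = thick_idealD(1)[OF P]
  let ?T = "{X \<in> Obj K. X \<boxtimes> B \<in> P}"
  have "A \<in> ideal_core K ?T"
    unfolding ideal_core_def
  proof (intro CollectI conjI ballI A)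
    fix C D assume C: "C \<in> Obj K" and D: "D \<in> Obj K"
    show "C \<boxtimes> A \<boxtimes> D \<in> Obj K" by (intro Tensor_Obj A C D)
    \<comment> \<open>Rebracketing makes \<open>D\<close> the middle factor of \<open>ACB\<close>,
      and \<open>C\<close> is an outer factor that \<open>P\<close> absorbs.\<close>
    have "isomorphic K (C \<boxtimes> A \<boxtimes> D \<boxtimes> B) (C \<boxtimes> (A \<boxtimes> D) \<boxtimes> B)"
      by (intro Tensor_isomorphic_left Assoc_isomorphic A B C D)
    moreover have "isomorphic K (C \<boxtimes> (A \<boxtimes> D) \<boxtimes> B) (C \<boxtimes> (A \<boxtimes> D \<boxtimes> B))"
      by (intro Assoc_isomorphic Tensor_Obj A B C D)
    ultimately show "C \<boxtimes> A \<boxtimes> D \<boxtimes> B \<in> P"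
      using thick_subcategory_cong[OF thP] thick_idealD(4)[OF P ACB[OF D] C] by blast
  qed
  then have left: "X \<boxtimes> B \<in> P" if "X \<in> generated_ideal K A" for X
    using that generated_ideal_subset_iff_core[OF A thick_subcategory_Tensor_preimage(1)[OF thP B]]
    by blast
  have "X \<boxtimes> Y \<in> P" if X: "X \<in> generated_ideal K A" and Y: "Y \<in> generated_ideal K B" for X Y
  proof -
    note gA = thick_ideal_generated[OF A]
    have X_Obj: "X \<in> Obj K" using thick_idealD(2)[OF gA X] .
    have "B \<in> ideal_core K {Y \<in> Obj K. X \<boxtimes> Y \<in> P}"
      unfolding ideal_core_def
    proof (intro CollectI conjI ballI B)
      fix C D assume C: "C \<in> Obj K" and D: "D \<in> Obj K"
      show "C \<boxtimes> B \<boxtimes> D \<in> Obj K" by (intro Tensor_Obj B C D)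
      \<comment> \<open>Rebracketing attaches \<open>C\<close> to \<open>X\<close>. Since
        \<open>X \<boxtimes> C\<close> is again in the ideal of \<open>A\<close>,
        \<open>left\<close> applies to it, and \<open>P\<close> absorbs \<open>D\<close>.\<close>
      have "isomorphic K (X \<boxtimes> C \<boxtimes> B \<boxtimes> D) (X \<boxtimes> C \<boxtimes> (B \<boxtimes> D))"
        by (intro Assoc_isomorphic Tensor_Obj X_Obj B C D)
      moreover have "isomorphic K (X \<boxtimes> C \<boxtimes> (B \<boxtimes> D)) (X \<boxtimes> (C \<boxtimes> (B \<boxtimes> D)))"
        by (intro Assoc_isomorphic Tensor_Obj X_Obj B C D)
      moreover have "isomorphic K (X \<boxtimes> (C \<boxtimes> B \<boxtimes> D)) (X \<boxtimes> (C \<boxtimes> (B \<boxtimes> D)))"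
        by (intro Tensor_isomorphic_right Assoc_isomorphic X_Obj B C D)
      moreover have "X \<boxtimes> C \<boxtimes> B \<boxtimes> D \<in> P"
        using thick_idealD(3)[OF P left[OF thick_idealD(3)[OF gA X C]] D] .
      ultimately show "X \<boxtimes> (C \<boxtimes> B \<boxtimes> D) \<in> P"
        using thick_subcategory_cong[OF thP] by blast
    qed
    then show ?thesis
      using Y generated_ideal_subset_iff_core[OF B
          thick_subcategory_Tensor_preimage(2)[OF thP X_Obj]]
      by blast
  qed
  then show ?thesis unfolding ideal_tensor_def by blast
qed

end


section \<open>The universal support\<close>

lemma SpcD:
  assumes "P \<in> Spc K"
  shows "thick_ideal K P" "P \<noteq> Obj K"
    and "thick_ideal K I \<Longrightarrow> thick_ideal K J \<Longrightarrow> ideal_tensor K I J \<subseteq> P \<Longrightarrow> I \<subseteq> P \<or> J \<subseteq> P"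
  using assms unfolding Spc_def prime_ideal_def by blast+

context monoidal_triangulated_category
begin

text \<open>An ideal containing the unit contains every \<open>Unit K \<boxtimes> A\<close>, hence
  every \<open>A\<close>, and so is not proper.\<close>

lemma Unit_notin_prime:
  assumes P: "P \<in> Spc K"
  shows "Unit K \<notin> P"
proof
  note I = SpcD(1)[OF P]
  assume U: "Unit K \<in> P"
  have "A \<in> P" if A: "A \<in> Obj K" for A
    using thick_idealD(3)[OF I U A] thick_subcategory_cong[OF thick_idealD(1)[OF I]]
      Lunit_isomorphic[OF A] by blast
  then have "P = Obj K" using thick_idealD(2)[OF I] by blast
  then show False using SpcD(2)[OF P] by blast
qed

text \<open>Each clause is the contrapositive of a closure property of primes, except the one for
  the unit, which is properness.\<close>

lemma pre_support_datum_V: "pre_support_datum K (Spc_topology K) (V K)"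
proof -
  note thP = thick_idealD(1)[OF SpcD(1)]
  have "V K A \<subseteq> topspace (Spc_topology K)" for A by (auto simp: V_def topspace_Spc)
  moreover have "V K Z = {}" if "zero_object K Z" for Z
    using thick_subcategoryD(2)[OF thP that] by (auto simp: V_def)
  moreover have "V K (Unit K) = topspace (Spc_topology K)"
    using Unit_notin_prime by (auto simp: V_def topspace_Spc)
  moreover have "V K S = V K A \<union> V K B" if "biproduct K A B S" for A B S
    using thick_subcategoryD(3)[OF thP that] by (auto simp: V_def)
  moreover have "V K (Shift K A) = V K A" if "A \<in> Obj K" for A
    using thick_subcategoryD(5)[OF thP that] by (auto simp: V_def)
  moreover have "V K A \<subseteq> V K B \<union> V K C" if "dist_triangle K A B C f g h" for A B C f g h
    using thick_subcategoryD(7)[OF thP that] by (auto simp: V_def)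
  ultimately show ?thesis unfolding pre_support_datum_def by (intro conjI allI impI ballI) blast+
qed

lemma support_datum_V: "support_datum K (Spc_topology K) (V K)"
  unfolding support_datum_def
proof (intro conjI ballI pre_support_datum_V)
  fix A B assume A: "A \<in> Obj K" and B: "B \<in> Obj K"
  have "(\<exists>C \<in> Obj K. A \<boxtimes> C \<boxtimes> B \<notin> P) \<longleftrightarrow> A \<notin> P \<and> B \<notin> P" if P: "P \<in> Spc K" for P
  proof
    assume "\<exists>C \<in> Obj K. A \<boxtimes> C \<boxtimes> B \<notin> P"
    then show "A \<notin> P \<and> B \<notin> P"
      using thick_idealD(3)[OF SpcD(1)[OF P] thick_idealD(3)[OF SpcD(1)[OF P]]]
        thick_idealD(4)[OF SpcD(1)[OF P]] A B Tensor_Obj[OF A] by blast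
  next
    assume "A \<notin> P \<and> B \<notin> P"
    \<comment> \<open>If all these products lay in \<open>P\<close>, so would the product of the two
      generated ideals; primality would then put one of them, with its generator, into
      \<open>P\<close>.\<close>
    then show "\<exists>C \<in> Obj K. A \<boxtimes> C \<boxtimes> B \<notin> P"
      using generated_ideal_tensor_subset[OF SpcD(1)[OF P] A B]
        SpcD(3)[OF P thick_ideal_generated[OF A] thick_ideal_generated[OF B]]
        generated_ideal_contains by blast
  qed
  then show "(\<Union>C \<in> Obj K. V K (A \<boxtimes> C \<boxtimes> B)) = V K A \<inter> V K B" unfolding V_def by blast
qed

lemma closedin_V: "A \<in> Obj K \<Longrightarrow> closedin (Spc_topology K) (V K A)"
  unfolding closedin_Spc by (rule exI[of _ "{A}"]) (auto simp: V_def Spc_closed_def)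

section \<open>The objects whose support misses a point\<close>

lemma thick_subcategory_complement_support:
  assumes "pre_support_datum K X \<sigma>"
  shows "thick_subcategory K {A \<in> Obj K. x \<notin> \<sigma> A}"
proof (rule thick_subcategoryI)
  fix Z assume "zero_object K Z"
  then show "Z \<in> {A \<in> Obj K. x \<notin> \<sigma> A}"
    using assms by (simp add: pre_support_datum_def zero_object_def)
next
  fix A B S assume S: "biproduct K A B S"
  then have "\<sigma> S = \<sigma> A \<union> \<sigma> B" using assms unfolding pre_support_datum_def by metis
  then show "S \<in> {A \<in> Obj K. x \<notin> \<sigma> A} \<longleftrightarrow>
      A \<in> {A \<in> Obj K. x \<notin> \<sigma> A} \<and> B \<in> {A \<in> Obj K. x \<notin> \<sigma> A}"
    using S by (auto simp: biproduct_def)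
next
  fix A assume "A \<in> Obj K"
  then show "Shift K A \<in> {A \<in> Obj K. x \<notin> \<sigma> A} \<longleftrightarrow> A \<in> {A \<in> Obj K. x \<notin> \<sigma> A}"
    using assms Shift_Obj by (simp add: pre_support_datum_def)
next
  fix A B C f g h
  assume t: "dist_triangle K A B C f g h"
    and BC: "B \<in> {A \<in> Obj K. x \<notin> \<sigma> A}" "C \<in> {A \<in> Obj K. x \<notin> \<sigma> A}"
  have "\<sigma> A \<subseteq> \<sigma> B \<union> \<sigma> C" using assms t unfolding pre_support_datum_def by metis
  then show "A \<in> {A \<in> Obj K. x \<notin> \<sigma> A}" using BC dist_triangle_Obj(1)[OF t] by blast
qed simp

text \<open>The tensor condition with the unit as one outer factor bounds the support of
  \<open>A \<boxtimes> B\<close> and of \<open>B \<boxtimes> A\<close> by that of \<open>A\<close>,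
  the unit being removed by an isomorphism.\<close>

lemma support_datum_ideal:
  assumes "support_datum K X \<sigma>"
  shows "thick_ideal K {A \<in> Obj K. x \<notin> \<sigma> A}"
  unfolding thick_ideal_iff
proof (intro conjI ballI)
  have pre: "pre_support_datum K X \<sigma>" using assms by (simp add: support_datum_def)
  show th: "thick_subcategory K {A \<in> Obj K. x \<notin> \<sigma> A}"
    using thick_subcategory_complement_support[OF pre] .
  have v: "\<sigma> (A \<boxtimes> C \<boxtimes> B) \<subseteq> \<sigma> A \<inter> \<sigma> B" if "A \<in> Obj K" "B \<in> Obj K" "C \<in> Obj K" for A B C
    using assms that unfolding support_datum_def by blast
  fix A B assume A: "A \<in> {A \<in> Obj K. x \<notin> \<sigma> A}" and B: "B \<in> Obj K"
  have "A \<boxtimes> B \<boxtimes> Unit K \<in> {A \<in> Obj K. x \<notin> \<sigma> A}" "Unit K \<boxtimes> B \<boxtimes> A \<in> {A \<in> Obj K. x \<notin> \<sigma> A}"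
    using v[of A "Unit K" B] v[of "Unit K" A B] A B by (simp_all add: Unit_Obj Tensor_Obj) blast+
  moreover have "isomorphic K (A \<boxtimes> B \<boxtimes> Unit K) (A \<boxtimes> B)"
    using A B by (intro Runit_isomorphic Tensor_Obj) auto
  moreover have "isomorphic K (Unit K \<boxtimes> B \<boxtimes> A) (B \<boxtimes> A)"
    using A B by (intro Lunit_isomorphic Tensor_isomorphic_left) auto
  ultimately show "A \<boxtimes> B \<in> {A \<in> Obj K. x \<notin> \<sigma> A}" "B \<boxtimes> A \<in> {A \<in> Obj K. x \<notin> \<sigma> A}"
    using thick_subcategory_cong[OF th] by blast+
qed

text \<open>The objects missing \<open>x\<close> form a thick ideal, so if \<open>A\<close> misses
  \<open>x\<close>, everything generated by \<open>A\<close> does too.\<close>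

lemma Phi_generated_support_datum:
  assumes "support_datum K X \<sigma>" "A \<in> Obj K"
  shows "Phi \<sigma> (generated_ideal K A) = \<sigma> A"
proof -
  have "x \<notin> Phi \<sigma> (generated_ideal K A) \<longleftrightarrow> x \<notin> \<sigma> A" for x
    using generated_ideal_subset_iff[OF support_datum_ideal[OF assms(1)], of A x] assms(2)
      thick_idealD(2)[OF thick_ideal_generated[OF assms(2)]]
    unfolding Phi_def by blast
  then show ?thesis by blast
qed

lemma support_datum_weak:
  assumes \<sigma>: "support_datum K X \<sigma>"
  shows "weak_support_datum K X \<sigma>"
  unfolding weak_support_datum_def
proof (intro conjI allI impI)
  show "pre_support_datum K X \<sigma>" using \<sigma> by (simp add: support_datum_def)
  fix I J assume I: "thick_ideal K I" and J: "thick_ideal K J"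
  show "Phi \<sigma> (ideal_tensor K I J) = Phi \<sigma> I \<inter> Phi \<sigma> J"
  proof (intro equalityI subsetI)
    fix x assume "x \<in> Phi \<sigma> (ideal_tensor K I J)"
    then obtain A B where AB: "A \<in> I" "B \<in> J" "x \<in> \<sigma> (A \<boxtimes> B)"
      unfolding Phi_def ideal_tensor_def by blast
    then have "x \<in> \<sigma> A" "x \<in> \<sigma> B"
      using thick_idealD(3,4)[OF support_datum_ideal[OF \<sigma>, of x]] thick_idealD(2)[OF I]
        thick_idealD(2)[OF J] by blast+
    then show "x \<in> Phi \<sigma> I \<inter> Phi \<sigma> J" using AB unfolding Phi_def by blast
  next
    fix x assume "x \<in> Phi \<sigma> I \<inter> Phi \<sigma> J"
    then obtain A B where AB: "A \<in> I" "B \<in> J" "x \<in> \<sigma> A \<inter> \<sigma> B" unfolding Phi_def by blast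
    then have "x \<in> (\<Union>C \<in> Obj K. \<sigma> (A \<boxtimes> C \<boxtimes> B))"
      using \<sigma> thick_idealD(2)[OF I] thick_idealD(2)[OF J] unfolding support_datum_def by blast
    \<comment> \<open>The middle factor is moved into the first ideal:
      \<open>A \<boxtimes> C \<in> I\<close>, so \<open>A \<boxtimes> C \<boxtimes> B\<close> is one
      of the products in \<open>ideal_tensor K I J\<close>.\<close>
    then obtain C where "C \<in> Obj K" "x \<in> \<sigma> (A \<boxtimes> C \<boxtimes> B)" by blast
    then show "x \<in> Phi \<sigma> (ideal_tensor K I J)"
      using thick_idealD(3)[OF I AB(1)] AB(2) unfolding Phi_def ideal_tensor_def by blast
  qed
qed

text \<open>For a thick ideal, missing \<open>x\<close> means lying in the core \<open>?Q\<close>.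
  Under this translation primality of \<open>?Q\<close> is the product formula for
  \<open>Phi\<close> read at \<open>x\<close>, and properness comes from the support of the unit
  being all of \<open>topspace X\<close>.\<close>

lemma weak_support_datum_prime:
  assumes \<sigma>: "weak_support_datum K X \<sigma>" and x: "x \<in> topspace X"
  shows "{A \<in> Obj K. x \<notin> Phi \<sigma> (generated_ideal K A)} \<in> Spc K"
proof -
  have pre: "pre_support_datum K X \<sigma>" using \<sigma> by (simp add: weak_support_datum_def)
  let ?N = "{A \<in> Obj K. x \<notin> \<sigma> A}"
  let ?Q = "ideal_core K ?N"
  note N = thick_subcategory_complement_support[OF pre, of x]
  have Q_iff: "x \<notin> Phi \<sigma> I \<longleftrightarrow> I \<subseteq> ?Q" if "thick_ideal K I" for I
    using thick_ideal_subset_core[OF that, of ?N] ideal_core_subset[OF N] thick_idealD(2)[OF that]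
    unfolding Phi_def by blast
  have "?Q = {A \<in> Obj K. x \<notin> Phi \<sigma> (generated_ideal K A)}"
    using Q_iff[OF thick_ideal_generated] generated_ideal_subset_iff[OF thick_ideal_core[OF N]]
    by (auto simp: ideal_core_def)
  moreover have "Unit K \<notin> ?Q"
    using ideal_core_subset[OF N] pre x unfolding pre_support_datum_def by blast
  then have "?Q \<noteq> Obj K" using Unit_Obj by blast
  moreover have "I \<subseteq> ?Q \<or> J \<subseteq> ?Q"
    if I: "thick_ideal K I" and J: "thick_ideal K J" and IJ: "ideal_tensor K I J \<subseteq> ?Q" for I J
  proof -
    \<comment> \<open>\<open>Q_iff\<close> speaks of thick ideals, and a set of products may fail to
      be one; the inclusion of \<open>?Q\<close> in \<open>?N\<close> gives this directly.\<close>
    have "x \<notin> Phi \<sigma> (ideal_tensor K I J)"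
      using IJ ideal_core_subset[OF N] unfolding Phi_def by blast
    then have "x \<notin> Phi \<sigma> I \<inter> Phi \<sigma> J" using \<sigma> I J unfolding weak_support_datum_def by metis
    then show ?thesis using Q_iff I J by blast
  qed
  ultimately show ?thesis
    unfolding Spc_def prime_ideal_def using thick_ideal_core[OF N] by auto
qed

text \<open>The required equation says that \<open>A \<in> f x\<close> exactly when
  \<open>x \<notin> Phi \<sigma> (generated_ideal K A)\<close>, which dictates \<open>f\<close>.
  Membership in \<open>extensional\<close> fixes its values off \<open>topspace X\<close> as
  \<open>undefined\<close>, so that uniqueness holds for total functions.\<close>

lemma weak_support_datum_universal:
  assumes \<sigma>: "weak_support_datum K X \<sigma>"
    and closed: "\<And>A. A \<in> Obj K \<Longrightarrow> closedin X (Phi \<sigma> (generated_ideal K A))"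
  shows "\<exists>!f. f \<in> extensional (topspace X) \<and> continuous_map X (Spc_topology K) f \<and>
    (\<forall>A \<in> Obj K. Phi \<sigma> (generated_ideal K A) = {x \<in> topspace X. f x \<in> V K A})"
proof (rule ex1I)
  let ?f = "\<lambda>x. {A \<in> Obj K. x \<notin> Phi \<sigma> (generated_ideal K A)}"
  let ?g = "restrict ?f (topspace X)"
  note f_Spc = weak_support_datum_prime[OF \<sigma>]
  \<comment> \<open>Preimages of closed sets become intersections of the sets assumed closed. The
    factor \<open>topspace X\<close> gives the right value for \<open>S = {}\<close>, where the
    intersection is the whole type.\<close>
  have preimage: "{x \<in> topspace X. ?g x \<in> Spc_closed K S} =
      topspace X \<inter> (\<Inter>A \<in> S. Phi \<sigma> (generated_ideal K A))" if "S \<subseteq> Obj K" for S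
    using f_Spc that unfolding Spc_closed_def by auto
  have "continuous_map X (Spc_topology K) ?g"
    unfolding continuous_map_closedin
  proof (intro conjI allI impI)
    show "?g \<in> topspace X \<rightarrow> topspace (Spc_topology K)" using f_Spc by (auto simp: topspace_Spc)
    fix C assume "closedin (Spc_topology K) C"
    then obtain S where S: "S \<subseteq> Obj K" "C = Spc_closed K S" unfolding closedin_Spc by blast
    have "closedin X (topspace X \<inter> (\<Inter>A \<in> S. Phi \<sigma> (generated_ideal K A)))"
    proof (cases "S = {}")
      case False
      then show ?thesis using closed S(1) by (intro closedin_Int closedin_INT) auto
    qed simp
    then show "closedin X {x \<in> topspace X. ?g x \<in> C}" using preimage S by simp
  qed
  moreover have "Phi \<sigma> (generated_ideal K A) = {x \<in> topspace X. ?g x \<in> V K A}"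
    if A: "A \<in> Obj K" for A
    \<comment> \<open>Closedness also places \<open>Phi \<sigma> (generated_ideal K A)\<close>
      inside \<open>topspace X\<close>.\<close>
    using f_Spc closedin_subset[OF closed[OF A]] A by (auto simp: V_def)
  ultimately show "?g \<in> extensional (topspace X) \<and> continuous_map X (Spc_topology K) ?g \<and>
    (\<forall>A \<in> Obj K. Phi \<sigma> (generated_ideal K A) = {x \<in> topspace X. ?g x \<in> V K A})"
    by simp
  fix h assume h: "h \<in> extensional (topspace X) \<and> continuous_map X (Spc_topology K) h \<and>
    (\<forall>A \<in> Obj K. Phi \<sigma> (generated_ideal K A) = {x \<in> topspace X. h x \<in> V K A})"
  have "h x = ?g x" if x: "x \<in> topspace X" for x
  proof -
    \<comment> \<open>Continuity makes \<open>h x\<close> a prime. It thus consists of objects, and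
      \<open>h x \<notin> V K A\<close> really means \<open>A \<in> h x\<close>.\<close>
    have hx: "h x \<in> Spc K"
      using h x unfolding continuous_map_def topspace_Spc by blast
    have "A \<in> h x \<longleftrightarrow> x \<notin> Phi \<sigma> (generated_ideal K A)" if "A \<in> Obj K" for A
      using h x that hx by (simp add: V_def)
    then show ?thesis using thick_idealD(2)[OF SpcD(1)[OF hx]] x by auto
  qed
  then show "h = ?g" using h by (intro extensionalityI[of h "topspace X"]) auto
qed

lemma support_datum_universal:
  assumes \<sigma>: "support_datum K X \<sigma>" and closed: "\<And>A. A \<in> Obj K \<Longrightarrow> closedin X (\<sigma> A)"
  shows "\<exists>!f. f \<in> extensional (topspace X) \<and> continuous_map X (Spc_topology K) f \<and>
    (\<forall>A \<in> Obj K. \<sigma> A = {x \<in> topspace X. f x \<in> V K A})"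
  using weak_support_datum_universal[OF support_datum_weak[OF \<sigma>]] closed
  by (simp add: Phi_generated_support_datum[OF \<sigma>])

end

theorem theorem1p3p1:
  fixes K :: "('o, 'm) mon_tri_cat"
  assumes "monoidal_triangulated_category K"
  shows
    "(support_datum K (Spc_topology K) (V K) \<and>
      (\<forall>A \<in> Obj K. closedin (Spc_topology K) (V K A)) \<and>
      (\<forall>(X :: 'x topology) \<sigma>.
         support_datum K X \<sigma> \<longrightarrow> (\<forall>A \<in> Obj K. closedin X (\<sigma> A)) \<longrightarrow>
         (\<exists>!f. f \<in> extensional (topspace X) \<and> continuous_map X (Spc_topology K) f \<and>
            (\<forall>A \<in> Obj K. \<sigma> A = {x \<in> topspace X. f x \<in> V K A})))) \<and>
     (weak_support_datum K (Spc_topology K) (V K) \<and>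
      (\<forall>A \<in> Obj K. closedin (Spc_topology K) (Phi (V K) (generated_ideal K A))) \<and>
      (\<forall>(X :: 'x topology) \<sigma>.
         weak_support_datum K X \<sigma> \<longrightarrow>
         (\<forall>A \<in> Obj K. closedin X (Phi \<sigma> (generated_ideal K A))) \<longrightarrow>
         (\<exists>!f. f \<in> extensional (topspace X) \<and> continuous_map X (Spc_topology K) f \<and>
            (\<forall>A \<in> Obj K. Phi \<sigma> (generated_ideal K A) = {x \<in> topspace X. f x \<in> V K A}))))"
proof -
  interpret monoidal_triangulated_category K by fact
  show ?thesis
  proof (intro conjI allI impI ballI)
    show "support_datum K (Spc_topology K) (V K)" by (rule support_datum_V)
    then show "weak_support_datum K (Spc_topology K) (V K)" by (rule support_datum_weak)
    fix A assume A: "A \<in> Obj K"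
    then show "closedin (Spc_topology K) (V K A)" by (rule closedin_V)
    \<comment> \<open>As \<open>V K\<close> is a support datum, its \<open>Phi\<close> on the ideal
      of \<open>A\<close> is \<open>V K A\<close>.\<close>
    then show "closedin (Spc_topology K) (Phi (V K) (generated_ideal K A))"
      by (simp only: Phi_generated_support_datum[OF support_datum_V A])
  qed (rule support_datum_universal weak_support_datum_universal; simp)+
qed

end
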